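(* For every integer $r\ge1$, \[ \lim_{n\to\infty}\frac{1}{n}\log P\left(\frac{S_{r+1,n}}{n}>y\right)=-I_r(y)\quad\text{for } y\in\left(\frac{1}{4^r},\frac{1}{2^r}\right), \] and \[ \lim_{n\to\infty}\frac{1}{n}\log P\left(\frac{S_{r+1,n}}{n}<y\right)=-I_r(y)\quad\text{for } y\in\left(0,\frac{1}{4^r}\right), \] where $I_r(y)=\sup_{\xi\in\mathbb{R}}\left(y\xi-\varphi^r(\xi)\right)$ is the Legendre transform of $\varphi^r$.
   Context: Let $\Omega_n$ be the set of rooted, planar, full binary trees with $n$ leaves, equipped with the uniform probability measure $P$ (the random binary tree model). Strahler ordering: leaves have order 1; an internal node whose children have different orders $r_1\ne r_2$ has order $\max\{r_1,r_2\}$; an internal node whose two children both have order $r$ has order $r+1$. A branch of order $r$ is a maximal connected path all of whose nodes have order $r$; $S_{r,n}(\tau)$ is the number of order-$r$ branches of $\tau\in\Omega_n$. Let $\varphi(\xi)=\frac{\xi}{4}+\log\cosh\frac{\xi}{4}$ and $\varphi^r$ its $r$-fold composition. *)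

theory Defs
  imports Complex_Main
begin

datatype btree = Leaf | Node btree btree

fun leaves :: "btree \<Rightarrow> nat" where
  "leaves Leaf = 1"
| "leaves (Node l r) = leaves l + leaves r"

fun strahler :: "btree \<Rightarrow> nat" where
  "strahler Leaf = 1"
| "strahler (Node l r) =
     (if strahler l = strahler r then strahler l + 1 else max (strahler l) (strahler r))"

text \<open>Number of non-root nodes of order k whose parent has order different from k,
  i.e. topmost nodes of order-k branches not containing the root.\<close>
fun branch_tops :: "nat \<Rightarrow> btree \<Rightarrow> nat" where
  "branch_tops k Leaf = 0"
| "branch_tops k (Node l r) =
     (if strahler l = k \<and> strahler (Node l r) \<noteq> k then 1 else 0)
   + (if strahler r = k \<and> strahler (Node l r) \<noteq> k then 1 else 0)
   + branch_tops k l + branch_tops k r"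

text \<open>S k t: number of branches of order k (maximal connected paths of order-k nodes);
  each such branch is identified by its topmost node.\<close>
definition S :: "nat \<Rightarrow> btree \<Rightarrow> nat" where
  "S k t = (if strahler t = k then 1 else 0) + branch_tops k t"

definition Omega :: "nat \<Rightarrow> btree set" where
  "Omega n = {t. leaves t = n}"

definition Prob :: "nat \<Rightarrow> (btree \<Rightarrow> bool) \<Rightarrow> real" where
  "Prob n E = real (card {t \<in> Omega n. E t}) / real (card (Omega n))"

definition phi :: "real \<Rightarrow> real" where
  "phi \<xi> = \<xi> / 4 + ln (cosh (\<xi> / 4))"

definition rate :: "nat \<Rightarrow> real \<Rightarrow> real" where
  "rate r y = (SUP \<xi>::real. y * \<xi> - (phi ^^ r) \<xi>)"

end

theory Submission
  imports Defs "HOL-Computational_Algebra.Formal_Power_Series" "HOL-Real_Asymp.Real_Asymp"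
begin

text \<open>
  Pruning the leaves of a tree lowers all Strahler orders by one, and a tree with \<open>m\<close> leaves is
  the pruning of exactly \<open>2^(n-2m) * C(n-2, 2m-2)\<close> trees with \<open>n\<close> leaves. Summing
  \<open>exp (\<xi> * S)\<close> over fibres turns a partition function growing like \<open>exp (\<mu> * n)\<close> into one growing
  like \<open>(2 + exp (\<mu> / 2))^n\<close>, by the even part of the binomial theorem. Relative to the \<open>4^n\<close>
  growth of the number of trees this is the map \<open>phi\<close>, so the limiting logarithmic moment
  generating function of the number of branches of order \<open>r + 1\<close> is the \<open>r\<close>-fold iterate of \<open>phi\<close>.
  This iterate is differentiable and strictly convex with slopes filling \<open>(0, 1/2^r)\<close> and slope
  \<open>1/4^r\<close> at 0, and the Gaertner-Ellis argument yields both tails.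
\<close>

section \<open>Pruning and its fibres\<close>

text \<open>Delete all leaves and contract the resulting unary nodes; the value at a single leaf is junk.\<close>
fun prune :: "btree \<Rightarrow> btree" where
  "prune Leaf = Leaf"
| "prune (Node l r) =
     (if l = Leaf then (if r = Leaf then Leaf else prune r)
      else if r = Leaf then prune l else Node (prune l) (prune r))"

lemma strahler_pos: "strahler t \<ge> 1"
  by (induction t) auto

lemma strahler_eq_1_iff: "strahler t = Suc 0 \<longleftrightarrow> t = Leaf"
proof (cases t)
  case (Node l r)
  then show ?thesis using strahler_pos[of l] strahler_pos[of r] by auto
qed auto

lemma leaves_pos: "leaves t > 0"
  by (induction t) auto

lemma leaves_eq_1_iff: "leaves t = Suc 0 \<longleftrightarrow> t = Leaf"
proof (cases t)
  case (Node l r)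
  then show ?thesis using leaves_pos[of l] leaves_pos[of r] by auto
qed auto

text \<open>A node with exactly one leaf child has the order of its other child, because that order
  is at least 2; contracting the node therefore loses no order. A node with two leaf children drops
  from order 2 to order 1.\<close>

lemma strahler_prune: "t \<noteq> Leaf \<Longrightarrow> strahler t = Suc (strahler (prune t))"
proof (induction t)
  case (Node l r)
  then show ?case
    using strahler_pos[of "prune l"] strahler_pos[of "prune r"] by auto
qed auto

text \<open>A contracted node shares its order with its surviving child, so contraction neither
  creates nor removes a branch top of order at least 2. The condition on \<open>k\<close> excludes
  \<open>Suc k = 1\<close>, the order of the deleted leaves.\<close>

lemma branch_tops_prune: "t \<noteq> Leaf \<Longrightarrow> k \<ge> 1 \<Longrightarrow> branch_tops (Suc k) t = branch_tops k (prune t)"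
proof (induction t)
  case (Node l r)
  show ?case
  proof (cases "l = Leaf \<or> r = Leaf")
    case True
    then show ?thesis
      using Node strahler_pos[of "prune l"] strahler_pos[of "prune r"]
        strahler_prune[of l] strahler_prune[of r] by auto
  next
    case False
    then show ?thesis
      using Node strahler_prune[of l] strahler_prune[of r] by auto
  qed
qed auto

lemma S_Suc_eq_S_prune: "t \<noteq> Leaf \<Longrightarrow> k \<ge> 1 \<Longrightarrow> S (Suc k) t = S k (prune t)"
  by (simp add: S_def branch_tops_prune strahler_prune)

text \<open>Every internal node has order at least 2, so each leaf is a branch by itself. This
  starts the induction on the order.\<close>

lemma S_1_eq_leaves: "S (Suc 0) t = leaves t"
proof -
  have "branch_tops (Suc 0) t = (if t = Leaf then 0 else leaves t)"
  proof (induction t)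
    case (Node l r)
    then show ?case
      using strahler_eq_1_iff[of "Node l r"] strahler_eq_1_iff[of l] strahler_eq_1_iff[of r]
      by auto
  qed auto
  then show ?thesis by (auto simp: S_def strahler_eq_1_iff)
qed

lemma finite_Omega: "finite (Omega n)"
proof (induction n rule: less_induct)
  case (less n)
  have "Omega n \<subseteq> insert Leaf (\<Union>i\<in>{..<n}. \<Union>j\<in>{..<n}. case_prod Node ` (Omega i \<times> Omega j))"
  proof
    fix t assume "t \<in> Omega n"
    then show "t \<in> insert Leaf (\<Union>i\<in>{..<n}. \<Union>j\<in>{..<n}. case_prod Node ` (Omega i \<times> Omega j))"
      using leaves_pos by (cases t) (auto simp: Omega_def image_iff)
  qed
  then show ?case
    by (rule finite_subset) (use less in auto)
qed

lemma Omega_0: "Omega 0 = {}"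
  using leaves_pos by (force simp: Omega_def)

lemma Omega_1: "Omega (Suc 0) = {Leaf}"
  by (auto simp: Omega_def leaves_eq_1_iff)

lemma Omega_nonempty: "n \<ge> 1 \<Longrightarrow> Omega n \<noteq> {}"
proof (induction n rule: nat_induct_at_least)
  case base
  then show ?case by (simp add: Omega_1)
next
  case (Suc n)
  then obtain t where "leaves t = n" by (auto simp: Omega_def)
  then have "Node Leaf t \<in> Omega (Suc n)" by (simp add: Omega_def)
  then show ?case by blast
qed

lemma card_Omega_pos: "n \<ge> 1 \<Longrightarrow> card (Omega n) > 0"
  using Omega_nonempty finite_Omega by (simp add: card_gt_0_iff)

section \<open>Counting the trees with a given pruning\<close>

definition prune_fibre :: "btree \<Rightarrow> nat \<Rightarrow> btree set" where
  "prune_fibre \<sigma> n = {t \<in> Omega n. t \<noteq> Leaf \<and> prune t = \<sigma>}"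

text \<open>The trees whose root survives: it becomes a leaf if both children are leaves, and stays
  a branching node if neither is. In the rest of the fibre the root is contracted.\<close>

definition branching_fibre :: "btree \<Rightarrow> nat \<Rightarrow> btree set" where
  "branching_fibre \<sigma> n =
     {t \<in> prune_fibre \<sigma> n. \<exists>l r. t = Node l r \<and> (l = Leaf \<longleftrightarrow> r = Leaf)}"

lemma finite_prune_fibre: "finite (prune_fibre \<sigma> n)"
  unfolding prune_fibre_def using finite_Omega by simp

text \<open>A contracted root has one leaf child, on the left or on the right, and its other child
  lies in the same fibre with one leaf fewer.\<close>

lemma prune_fibre_split:
  "prune_fibre \<sigma> n = branching_fibre \<sigma> n \<union>
     (Node Leaf ` prune_fibre \<sigma> (n - 1) \<union> (\<lambda>t. Node t Leaf) ` prune_fibre \<sigma> (n - 1))"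
  (is "?L = ?B \<union> (?C \<union> ?D)")
proof
  show "?L \<subseteq> ?B \<union> (?C \<union> ?D)"
  proof
    fix t assume t: "t \<in> ?L"
    then obtain l r where lr: "t = Node l r"
      by (cases t) (auto simp: prune_fibre_def)
    then show "t \<in> ?B \<union> (?C \<union> ?D)"
      using t by (auto simp: prune_fibre_def branching_fibre_def Omega_def split: if_splits)
  qed
  \<comment> \<open>Guards against truncation of \<open>n - 1\<close> at \<open>n = 0\<close>: the
    fibre over 0 leaves is empty.\<close>
  have "n > 0" if "t \<in> prune_fibre \<sigma> (n - 1)" for t
    using that leaves_pos[of t] by (auto simp: prune_fibre_def Omega_def)
  then show "?B \<union> (?C \<union> ?D) \<subseteq> ?L"
    by (auto simp: prune_fibre_def branching_fibre_def Omega_def)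
qed

lemma card_prune_fibre_split:
  "card (prune_fibre \<sigma> n) = card (branching_fibre \<sigma> n) + 2 * card (prune_fibre \<sigma> (n - 1))"
proof -
  let ?C = "Node Leaf ` prune_fibre \<sigma> (n - 1)" and ?D = "(\<lambda>t. Node t Leaf) ` prune_fibre \<sigma> (n - 1)"
  have fin: "finite (branching_fibre \<sigma> n)" "finite ?C" "finite ?D"
    using finite_prune_fibre by (auto simp: branching_fibre_def)
  have "card (?C \<union> ?D) = card ?C + card ?D"
    using fin by (intro card_Un_disjoint) (auto simp: prune_fibre_def)
  moreover have "card (branching_fibre \<sigma> n \<union> (?C \<union> ?D)) = card (branching_fibre \<sigma> n) + card (?C \<union> ?D)"
    using fin by (intro card_Un_disjoint) (auto simp: prune_fibre_def branching_fibre_def)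
  moreover have "card ?C = card (prune_fibre \<sigma> (n - 1))" "card ?D = card (prune_fibre \<sigma> (n - 1))"
    by (auto intro!: card_image inj_onI)
  ultimately show ?thesis using prune_fibre_split[of \<sigma> n] by simp
qed

lemma branching_fibre_Leaf: "branching_fibre Leaf n = (if n = 2 then {Node Leaf Leaf} else {})"
  by (auto simp: branching_fibre_def prune_fibre_def Omega_def split: if_splits)

text \<open>When the root survives as a branching node, its two subtrees are pruned independently,
  which makes the count a convolution.\<close>

lemma branching_fibre_Node:
  "branching_fibre (Node a b) n =
     (\<Union>i\<in>{0..n}. case_prod Node ` (prune_fibre a i \<times> prune_fibre b (n - i)))" (is "?L = ?R")
proof
  show "?R \<subseteq> ?L"
    by (auto simp: branching_fibre_def prune_fibre_def Omega_def)
  show "?L \<subseteq> ?R"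
  proof
    fix t assume t: "t \<in> ?L"
    then obtain l r where lr: "t = Node l r" "l = Leaf \<longleftrightarrow> r = Leaf"
      by (auto simp: branching_fibre_def)
    with t have "l \<noteq> Leaf" "r \<noteq> Leaf" "prune l = a" "prune r = b" "leaves l + leaves r = n"
      by (auto simp: branching_fibre_def prune_fibre_def Omega_def split: if_splits)
    then have "leaves l \<in> {0..n}" "(l, r) \<in> prune_fibre a (leaves l) \<times> prune_fibre b (n - leaves l)"
      by (auto simp: prune_fibre_def Omega_def)
    then show "t \<in> ?R" using lr(1) by force
  qed
qed

lemma card_branching_fibre_Node:
  "card (branching_fibre (Node a b) n) =
     (\<Sum>i=0..n. card (prune_fibre a i) * card (prune_fibre b (n - i)))"
proof -
  have "card (branching_fibre (Node a b) n) =
     (\<Sum>i=0..n. card (case_prod Node ` (prune_fibre a i \<times> prune_fibre b (n - i))))"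
    unfolding branching_fibre_Node
  proof (intro card_UN_disjoint ballI impI)
    show "finite (case_prod Node ` (prune_fibre a i \<times> prune_fibre b (n - i)))" for i
      by (simp add: finite_prune_fibre)
  qed (auto simp: prune_fibre_def Omega_def)
  also have "\<dots> = (\<Sum>i=0..n. card (prune_fibre a i) * card (prune_fibre b (n - i)))"
    by (intro sum.cong refl, subst card_image) (auto intro!: inj_onI simp: card_cartesian_product)
  finally show ?thesis .
qed

definition fibre_fps :: "btree \<Rightarrow> real fps" where
  "fibre_fps \<sigma> = Abs_fps (\<lambda>n. real (card (prune_fibre \<sigma> n)))"

definition branching_fps :: "btree \<Rightarrow> real fps" where
  "branching_fps \<sigma> = Abs_fps (\<lambda>n. real (card (branching_fibre \<sigma> n)))"

lemma prune_fibre_0: "prune_fibre \<sigma> 0 = {}"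
  by (auto simp: prune_fibre_def Omega_0)

text \<open>The factor \<open>1 / (1 - 2X)\<close> accounts for the chain of contracted nodes above
  the surviving root: each costs one leaf and has two orientations.\<close>

lemma fibre_fps_eq: "fibre_fps \<sigma> * (1 - 2 * fps_X) = branching_fps \<sigma>"
proof (rule fps_ext)
  fix n
  have "fibre_fps \<sigma> * (1 - 2 * fps_X) = fibre_fps \<sigma> - fps_const 2 * (fps_X * fibre_fps \<sigma>)"
    by (simp add: numeral_fps_const[symmetric] algebra_simps)
  then have "fps_nth (fibre_fps \<sigma> * (1 - 2 * fps_X)) n =
      fps_nth (fibre_fps \<sigma>) n - 2 * fps_nth (fps_X * fibre_fps \<sigma>) n"
    by simp
  also have "\<dots> = fps_nth (branching_fps \<sigma>) n"
    using card_prune_fibre_split[of \<sigma> n]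
    by (auto simp: fibre_fps_def branching_fps_def prune_fibre_0)
  finally show "fps_nth (fibre_fps \<sigma> * (1 - 2 * fps_X)) n = fps_nth (branching_fps \<sigma>) n" .
qed

lemma branching_fps_Leaf: "branching_fps Leaf = fps_X ^ 2"
  by (rule fps_ext) (simp add: branching_fps_def branching_fibre_Leaf)

lemma branching_fps_Node: "branching_fps (Node a b) = fibre_fps a * fibre_fps b"
  by (rule fps_ext) (simp add: branching_fps_def fibre_fps_def card_branching_fibre_Node fps_mult_nth)

text \<open>Each of the \<open>2m - 1\<close> nodes of a tree with \<open>m\<close> leaves carries a
  chain, contributing \<open>1 / (1 - 2X)\<close>, and each of its leaves comes from a node with two
  leaf children, contributing \<open>X^2\<close>. Multiplying out avoids division of power
  series.\<close>

lemma fibre_fps_closed_form: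
  "fibre_fps \<sigma> * (1 - 2 * fps_X) ^ (2 * leaves \<sigma> - 1) = fps_X ^ (2 * leaves \<sigma>)"
proof (induction \<sigma>)
  case Leaf
  then show ?case using fibre_fps_eq[of Leaf] by (simp add: branching_fps_Leaf)
next
  case (Node a b)
  let ?q = "1 - 2 * fps_X :: real fps"
  have "2 * leaves (Node a b) - 1 = Suc ((2 * leaves a - 1) + (2 * leaves b - 1))"
    using leaves_pos[of a] leaves_pos[of b] by simp
  then have "fibre_fps (Node a b) * ?q ^ (2 * leaves (Node a b) - 1) =
      (fibre_fps (Node a b) * ?q) * (?q ^ (2 * leaves a - 1) * ?q ^ (2 * leaves b - 1))"
    by (simp only: power_Suc power_add mult.assoc)
  also have "\<dots> = (fibre_fps a * ?q ^ (2 * leaves a - 1)) * (fibre_fps b * ?q ^ (2 * leaves b - 1))"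
    unfolding fibre_fps_eq branching_fps_Node by (simp only: mult_ac)
  also have "\<dots> = fps_X ^ (2 * leaves (Node a b))"
    unfolding Node.IH by (simp add: power_add algebra_simps)
  finally show ?case .
qed

lemma card_prune_fibre:
  assumes "leaves \<sigma> = Suc j"
  shows "real (card (prune_fibre \<sigma> (N + 2))) = real (N choose (2 * j)) * 2 ^ (N - 2 * j)"
proof -
  let ?q = "1 - fps_const 2 * fps_X :: real fps"
  \<comment> \<open>The negative binomial series. Its coefficient at \<open>k = N - 2 * j\<close> is
    \<open>N choose (N - 2 * j)\<close>, since \<open>Suc (2 * j) + k - 1 = N\<close>; for
    \<open>N < 2 * j\<close> both sides of the claim vanish.\<close>
  have inv: "inverse (?q ^ Suc (2 * j)) =
      Abs_fps (\<lambda>k. of_nat ((Suc (2 * j) + k - 1) choose k) * 2 ^ k)"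
    by (rule one_minus_const_fps_X_neg_power') simp
  have q0: "fps_nth (?q ^ Suc (2 * j)) 0 \<noteq> 0"
    by (simp add: fps_nth_power_0)
  have closed: "fibre_fps \<sigma> * ?q ^ Suc (2 * j) = fps_X ^ (2 * j + 2)"
    using fibre_fps_closed_form[of \<sigma>] assms by (simp add: numeral_fps_const)
  have "fibre_fps \<sigma> = fibre_fps \<sigma> * (?q ^ Suc (2 * j) * inverse (?q ^ Suc (2 * j)))"
    by (simp only: inverse_mult_eq_1'[OF q0] mult_1_right)
  also have "\<dots> = fps_X ^ (2 * j + 2) * inverse (?q ^ Suc (2 * j))"
    by (simp only: mult.assoc[symmetric] closed)
  finally have "fibre_fps \<sigma> = fps_X ^ (2 * j + 2) * inverse (?q ^ Suc (2 * j))" .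
  then have "fps_nth (fibre_fps \<sigma>) (N + 2) =
      (if N < 2 * j then 0 else real (N choose (N - 2 * j)) * 2 ^ (N - 2 * j))"
    unfolding inv by (auto simp only: fps_X_power_mult_nth fps_nth_Abs_fps) simp_all
  then show ?thesis
    by (auto simp: fibre_fps_def binomial_symmetric[symmetric])
qed

lemma leaves_prune: "t \<noteq> Leaf \<Longrightarrow> 2 * leaves (prune t) \<le> leaves t"
  by (induction t) auto

text \<open>For the Catalan numbers \<open>a m = card (Omega m)\<close>, \<open>touchard a N = a (N + 2)\<close> is Touchard's identity.
  The truncated subtraction \<open>N - 2 * j\<close> only occurs where the binomial coefficient vanishes.\<close>
definition touchard :: "(nat \<Rightarrow> real) \<Rightarrow> nat \<Rightarrow> real" where
  "touchard a N = (\<Sum>j\<le>N. real (N choose (2 * j)) * 2 ^ (N - 2 * j) * a (Suc j))"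

lemma sum_Omega_prune:
  fixes f :: "btree \<Rightarrow> real"
  shows "(\<Sum>t\<in>Omega (N + 2). f (prune t)) = touchard (\<lambda>m. \<Sum>\<sigma>\<in>Omega m. f \<sigma>) N"
proof -
  \<comment> \<open>The sum is grouped by the pruned tree, paired with its number of leaves less
    one. The range \<open>{..N}\<close> suffices because pruning at least halves the number of
    leaves.\<close>
  let ?A = "SIGMA j:{..N}. Omega (Suc j)"
  have nl: "t \<noteq> Leaf" if "t \<in> Omega (N + 2)" for t
    using that by (auto simp: Omega_def)
  have inA: "(leaves (prune t) - 1, prune t) \<in> ?A" if "t \<in> Omega (N + 2)" for t
    using leaves_prune[OF nl[OF that]] leaves_pos[of "prune t"] that by (auto simp: Omega_def)
  have fib: "{t \<in> Omega (N + 2). (leaves (prune t) - 1, prune t) = (j, \<sigma>)} = prune_fibre \<sigma> (N + 2)"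
    if "(j, \<sigma>) \<in> ?A" for j \<sigma>
    using that nl by (auto simp: prune_fibre_def Omega_def)
  have finA: "finite ?A" by (simp add: finite_Omega)
  have "(\<Sum>t\<in>Omega (N + 2). f (prune t)) =
      (\<Sum>p\<in>?A. \<Sum>t\<in>{t \<in> Omega (N + 2). (leaves (prune t) - 1, prune t) = p}. f (prune t))"
    using inA by (intro sum.group[symmetric] finite_Omega finA) blast
  also have "\<dots> = (\<Sum>(j,\<sigma>)\<in>?A. real (N choose (2 * j)) * 2 ^ (N - 2 * j) * f \<sigma>)"
  proof (rule sum.cong[OF refl])
    fix p assume "p \<in> ?A"
    then obtain j \<sigma> where p: "p = (j, \<sigma>)" and js: "j \<in> {..N}" "\<sigma> \<in> Omega (Suc j)"
      by blast
    then have "(\<Sum>t\<in>{t \<in> Omega (N + 2). (leaves (prune t) - 1, prune t) = (j, \<sigma>)}. f (prune t))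
        = (\<Sum>t\<in>prune_fibre \<sigma> (N + 2). f \<sigma>)"
      by (subst fib) (auto simp: prune_fibre_def)
    also have "\<dots> = real (N choose (2 * j)) * 2 ^ (N - 2 * j) * f \<sigma>"
      using js card_prune_fibre[of \<sigma> j N] by (simp add: Omega_def)
    finally show "(\<Sum>t\<in>{t \<in> Omega (N + 2). (leaves (prune t) - 1, prune t) = p}. f (prune t))
       = (case p of (j, \<sigma>) \<Rightarrow> real (N choose (2 * j)) * 2 ^ (N - 2 * j) * f \<sigma>)"
      unfolding p prod.case .
  qed
  also have "\<dots> = touchard (\<lambda>m. \<Sum>\<sigma>\<in>Omega m. f \<sigma>) N"
    by (simp add: touchard_def sum.Sigma finite_Omega sum_distrib_left)
  finally show ?thesis .
qed

section \<open>Growth of the partition functions\<close>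

text \<open>Averaging the binomial expansions at \<open>v\<close> and at \<open>-v\<close> cancels
  the odd powers of \<open>v\<close>.\<close>

lemma sum_choose_even:
  fixes u v :: real
  shows "(\<Sum>j\<le>N. real (N choose (2 * j)) * u ^ (N - 2 * j) * v ^ (2 * j)) = ((u + v) ^ N + (u - v) ^ N) / 2"
proof -
  have split: "(\<Sum>k\<le>Suc (2 * M). g k) = (\<Sum>j\<le>M. g (2 * j) + g (Suc (2 * j)))" for g :: "nat \<Rightarrow> real" and M
    by (induction M) auto
  \<comment> \<open>The expansion is padded with vanishing binomials up to the odd index
    \<open>2 * N + 1\<close>, so that its terms pair off as even and odd.\<close>
  have ext: "(w + u) ^ N = (\<Sum>k\<le>Suc (2 * N). real (N choose k) * w ^ k * u ^ (N - k))" for w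
    unfolding binomial_ring by (rule sum.mono_neutral_left) auto
  have "((u + v) ^ N + (u - v) ^ N) / 2 = ((v + u) ^ N + (- v + u) ^ N) / 2"
    by (simp add: add.commute)
  also have "\<dots> = (\<Sum>j\<le>N. real (N choose (2 * j)) * u ^ (N - 2 * j) * v ^ (2 * j))"
    unfolding ext sum.distrib[symmetric] split sum_divide_distrib
    by (intro sum.cong refl) (simp add: power_mult)
  finally show ?thesis ..
qed

lemma touchard_exp:
  "touchard (\<lambda>m. exp (\<nu> * real m)) N =
     exp \<nu> * ((2 + exp (\<nu> / 2)) ^ N + (2 - exp (\<nu> / 2)) ^ N) / 2"
proof -
  have "exp (\<nu> * real (Suc j)) = exp \<nu> * exp (\<nu> / 2) ^ (2 * j)" for j
    by (simp add: exp_of_nat_mult[symmetric] exp_add[symmetric] algebra_simps)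
  then have "touchard (\<lambda>m. exp (\<nu> * real m)) N =
      exp \<nu> * (\<Sum>j\<le>N. real (N choose (2 * j)) * 2 ^ (N - 2 * j) * exp (\<nu> / 2) ^ (2 * j))"
    by (simp only: touchard_def sum_distrib_left mult_ac)
  then show ?thesis by (simp add: sum_choose_even)
qed

text \<open>The case \<open>u = v = 2\<close> of the even binomial sum; \<open>0 ^ N\<close> is the
  power of \<open>u - v\<close>.\<close>

lemma touchard_power_4: "touchard (\<lambda>m. 4 ^ m) N = 2 * (4 ^ N + 0 ^ N)"
proof -
  have "touchard (\<lambda>m. 4 ^ m) N =
      4 * (\<Sum>j\<le>N. real (N choose (2 * j)) * 2 ^ (N - 2 * j) * 2 ^ (2 * j))"
    unfolding touchard_def sum_distrib_left by (intro sum.cong refl) (simp add: power_mult)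
  then show ?thesis by (simp add: sum_choose_even)
qed

text \<open>Indices with \<open>2 * j > N\<close> carry a zero coefficient. Restricting the
  hypothesis to the others keeps \<open>Suc j < N + 2\<close>, which lets strong induction supply
  it.\<close>

lemma touchard_mono:
  assumes "\<And>j. 2 * j \<le> N \<Longrightarrow> a (Suc j) \<le> b (Suc j)"
  shows "touchard a N \<le> touchard b N"
  unfolding touchard_def
proof (rule sum_mono)
  fix j assume "j \<in> {..N}"
  show "real (N choose (2 * j)) * 2 ^ (N - 2 * j) * a (Suc j) \<le> real (N choose (2 * j)) * 2 ^ (N - 2 * j) * b (Suc j)"
  proof (cases "2 * j \<le> N")
    case True
    then show ?thesis by (intro mult_left_mono assms) auto
  qed (simp add: binomial_eq_0)
qed

lemma touchard_cmult: "touchard (\<lambda>m. K * a m) N = K * touchard a N"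
  by (simp add: touchard_def sum_distrib_left mult_ac)

text \<open>Of the two powers in \<open>touchard_exp\<close>, that of
  \<open>2 + exp (\<nu> / 2)\<close> dominates. The divisor is \<open>n + 2\<close> because
  \<open>touchard a n\<close> belongs to trees with \<open>n + 2\<close> leaves.\<close>

lemma touchard_exp_growth:
  assumes "K > 0"
  shows "(\<lambda>n. ln (K * touchard (\<lambda>m. exp (\<nu> * real m)) n) / real (n + 2))
           \<longlonglongrightarrow> ln (2 + exp (\<nu> / 2))"
proof -
  define v where "v = exp (\<nu> / 2)"
  \<comment> \<open>Ratio of the two bases. It may be negative, but its modulus is below 1, so the
    correction \<open>1 + q ^ n\<close> stays positive and tends to 1.\<close>
  define q where "q = (2 - v) / (2 + v)"
  have v: "v > 0" by (simp add: v_def)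
  have q: "\<bar>q\<bar> < 1" using v by (simp add: q_def abs_if field_simps)
  have q1: "1 + q ^ n > 0" for n
  proof (cases n)
    case (Suc m)
    have "\<bar>q ^ n\<bar> < 1" unfolding power_abs Suc using q power_le_one[of "\<bar>q\<bar>" m] mult_left_le[of "\<bar>q\<bar> ^ m" "\<bar>q\<bar>"] by simp
    then show ?thesis by linarith
  qed auto
  have eq: "ln (K * touchard (\<lambda>m. exp (\<nu> * real m)) n) =
      (ln (K * exp \<nu> / 2) + ln (1 + q ^ n)) + real n * ln (2 + v)" for n
  proof -
    have "K * touchard (\<lambda>m. exp (\<nu> * real m)) n = (K * exp \<nu> / 2) * ((2 + v) ^ n * (1 + q ^ n))"
      using v by (simp add: touchard_exp v_def[symmetric] q_def field_simps)
    also have "ln \<dots> = ln (K * exp \<nu> / 2) + (ln ((2 + v) ^ n) + ln (1 + q ^ n))"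
      using assms v q1 by (subst ln_mult_pos; simp add: ln_mult_pos)
    finally show ?thesis using v by (simp add: ln_realpow)
  qed
  have "(\<lambda>n. q ^ n) \<longlonglongrightarrow> 0" using q by (intro LIMSEQ_power_zero) simp
  then have "(\<lambda>n. ln (K * exp \<nu> / 2) + ln (1 + q ^ n)) \<longlonglongrightarrow> ln (K * exp \<nu> / 2) + ln (1 + 0)"
    by (intro tendsto_add tendsto_const tendsto_ln) auto
  moreover have "filterlim (\<lambda>n. real (n + 2)) at_infinity sequentially"
    by (rule filterlim_at_top_imp_at_infinity) real_asymp
  ultimately have "(\<lambda>n. (ln (K * exp \<nu> / 2) + ln (1 + q ^ n)) / real (n + 2)) \<longlonglongrightarrow> 0"
    by (rule tendsto_divide_0)
  moreover have "(\<lambda>n. real n / real (n + 2)) \<longlonglongrightarrow> 1" by real_asymp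
  ultimately have "(\<lambda>n. (ln (K * exp \<nu> / 2) + ln (1 + q ^ n)) / real (n + 2) + real n / real (n + 2) * ln (2 + v))
      \<longlonglongrightarrow> 0 + 1 * ln (2 + v)"
    by (intro tendsto_intros)
  then show ?thesis unfolding eq by (simp add: add_divide_distrib v_def)
qed

text \<open>Turns a limiting growth rate into bounds valid for all \<open>m \<ge> 1\<close>, as
  needed because \<open>touchard\<close> involves all small indices too.\<close>

lemma exponential_bounds:
  fixes a :: "nat \<Rightarrow> real"
  assumes pos: "\<And>m. m \<ge> 1 \<Longrightarrow> a m > 0"
    and lim: "(\<lambda>m. ln (a m) / real m) \<longlonglongrightarrow> \<mu>" and e: "\<epsilon> > 0"
  obtains C where "C > 0" "\<And>m. m \<ge> 1 \<Longrightarrow> a m \<le> C * exp ((\<mu> + \<epsilon>) * real m)"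
    "\<And>m. m \<ge> 1 \<Longrightarrow> exp ((\<mu> - \<epsilon>) * real m) \<le> C * a m"
proof -
  from lim e have "\<forall>\<^sub>F m in sequentially. \<bar>ln (a m) / real m - \<mu>\<bar> < \<epsilon>"
    by (auto simp: tendsto_iff dist_real_def)
  then obtain M where M: "\<And>m. m \<ge> M \<Longrightarrow> \<bar>ln (a m) / real m - \<mu>\<bar> < \<epsilon>"
    by (auto simp: eventually_sequentially)
  \<comment> \<open>The sum dominates each of the finitely many early ratios, and the summand 1
    covers all \<open>m > M\<close>.\<close>
  define C where "C = 1 + (\<Sum>m\<in>{1..M}. a m / exp ((\<mu> + \<epsilon>) * real m) + exp ((\<mu> - \<epsilon>) * real m) / a m)"
  have nn: "a m / exp ((\<mu> + \<epsilon>) * real m) + exp ((\<mu> - \<epsilon>) * real m) / a m \<ge> 0" if "m \<in> {1..M}" for m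
    using pos[of m] that by auto
  have C1: "C \<ge> 1" unfolding C_def using sum_nonneg[of "{1..M}", OF nn] by simp
  have key: "a m / exp ((\<mu> + \<epsilon>) * real m) \<le> C \<and> exp ((\<mu> - \<epsilon>) * real m) / a m \<le> C" if m: "m \<ge> 1" for m
  proof (cases "m \<le> M")
    case True
    then have "m \<in> {1..M}" using m by simp
    then have "a m / exp ((\<mu> + \<epsilon>) * real m) + exp ((\<mu> - \<epsilon>) * real m) / a m \<le> C"
      unfolding C_def using member_le_sum[of m "{1..M}", OF _ nn] by force
    moreover have "a m / exp ((\<mu> + \<epsilon>) * real m) > 0" "exp ((\<mu> - \<epsilon>) * real m) / a m > 0"
      using pos[OF m] by auto
    ultimately show ?thesis by linarith
  next
    case False
    then have "ln (a m) / real m < \<mu> + \<epsilon>" "\<mu> - \<epsilon> < ln (a m) / real m" using M[of m] by auto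
    then have "ln (a m) \<le> (\<mu> + \<epsilon>) * real m" "(\<mu> - \<epsilon>) * real m \<le> ln (a m)"
      using m by (auto simp: field_simps)
    then have "a m \<le> exp ((\<mu> + \<epsilon>) * real m)" "exp ((\<mu> - \<epsilon>) * real m) \<le> a m"
      using pos[OF m] by (metis exp_le_cancel_iff exp_ln)+
    then have "a m / exp ((\<mu> + \<epsilon>) * real m) \<le> 1" "exp ((\<mu> - \<epsilon>) * real m) / a m \<le> 1"
      using pos[OF m] by auto
    then show ?thesis using C1 by linarith
  qed
  show ?thesis
  proof (rule that[of C])
    show "a m \<le> C * exp ((\<mu> + \<epsilon>) * real m)" if "m \<ge> 1" for m
      using key[OF that] by (simp add: pos_divide_le_eq)
    show "exp ((\<mu> - \<epsilon>) * real m) \<le> C * a m" if "m \<ge> 1" for m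
      using key[OF that] pos[OF that] by (simp add: pos_divide_le_eq)
  qed (use C1 in auto)
qed

lemma touchard_pos:
  assumes "\<And>m. m \<ge> 1 \<Longrightarrow> a m > 0"
  shows "touchard a N > 0"
proof -
  have "0 < (2::real) ^ N * a 1" using assms by simp
  also have "\<dots> = (\<Sum>j\<in>{0}. real (N choose (2 * j)) * 2 ^ (N - 2 * j) * a (Suc j))" by simp
  also have "\<dots> \<le> touchard a N"
    unfolding touchard_def using assms by (intro sum_mono2) (auto simp: less_imp_le)
  finally show ?thesis .
qed

text \<open>The transform is monotone and its effect on pure exponentials is known, so
  \<open>a\<close> is squeezed between exponentials of rates \<open>\<mu> - \<epsilon>\<close> and
  \<open>\<mu> + \<epsilon>\<close>; continuity in \<open>\<epsilon>\<close> closes the gap.\<close>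

lemma touchard_growth:
  fixes a :: "nat \<Rightarrow> real"
  assumes pos: "\<And>m. m \<ge> 1 \<Longrightarrow> a m > 0" and lim: "(\<lambda>m. ln (a m) / real m) \<longlonglongrightarrow> \<mu>"
  shows "(\<lambda>n. ln (touchard a n) / real (n + 2)) \<longlonglongrightarrow> ln (2 + exp (\<mu> / 2))"
proof (rule order_tendstoI)
  have cont: "((\<lambda>\<epsilon>. ln (2 + exp ((\<mu> + \<epsilon>) / 2))) \<longlongrightarrow> ln (2 + exp ((\<mu> + 0) / 2))) (at_right 0)"
    "((\<lambda>\<epsilon>. ln (2 + exp ((\<mu> - \<epsilon>) / 2))) \<longlongrightarrow> ln (2 + exp ((\<mu> - 0) / 2))) (at_right 0)"
    by (intro tendsto_intros; simp add: add_pos_pos less_imp_neq[THEN not_sym])+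
  have epos: "\<forall>\<^sub>F \<epsilon> in at_right 0. (\<epsilon>::real) > 0" by (simp add: eventually_at_right_less)
  {
    fix c assume "ln (2 + exp (\<mu> / 2)) < c"
    then have "\<forall>\<^sub>F \<epsilon> in at_right 0. ln (2 + exp ((\<mu> + \<epsilon>) / 2)) < c"
      using order_tendstoD(2)[OF cont(1)] by simp
    with epos have "\<forall>\<^sub>F \<epsilon> in at_right 0. \<epsilon> > 0 \<and> ln (2 + exp ((\<mu> + \<epsilon>) / 2)) < c"
      by eventually_elim simp
    then obtain \<epsilon> where e: "\<epsilon> > 0" "ln (2 + exp ((\<mu> + \<epsilon>) / 2)) < c"
      using eventually_happens'[OF trivial_limit_at_right_real] by blast
    obtain C where C: "C > 0"
      "\<And>m. m \<ge> 1 \<Longrightarrow> a m \<le> C * exp ((\<mu> + \<epsilon>) * real m)"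
      by (rule exponential_bounds[OF pos lim e(1)]) blast+
    have le: "ln (touchard a n) / real (n + 2) \<le> ln (C * touchard (\<lambda>m. exp ((\<mu> + \<epsilon>) * real m)) n) / real (n + 2)" for n
    proof -
      have "touchard a n \<le> C * touchard (\<lambda>m. exp ((\<mu> + \<epsilon>) * real m)) n"
        unfolding touchard_cmult[symmetric] by (rule touchard_mono, rule C(2)) simp
      then show ?thesis using touchard_pos[of a n, OF pos] by (intro divide_right_mono) auto
    qed
    have "\<forall>\<^sub>F n in sequentially. ln (C * touchard (\<lambda>m. exp ((\<mu> + \<epsilon>) * real m)) n) / real (n + 2) < c"
      using order_tendstoD(2)[OF touchard_exp_growth[OF C(1)] e(2)] .
    then show "\<forall>\<^sub>F n in sequentially. ln (touchard a n) / real (n + 2) < c"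
      by eventually_elim (rule le_less_trans[OF le])
  next
    fix c assume "c < ln (2 + exp (\<mu> / 2))"
    then have "\<forall>\<^sub>F \<epsilon> in at_right 0. c < ln (2 + exp ((\<mu> - \<epsilon>) / 2))"
      using order_tendstoD(1)[OF cont(2)] by simp
    with epos have "\<forall>\<^sub>F \<epsilon> in at_right 0. \<epsilon> > 0 \<and> c < ln (2 + exp ((\<mu> - \<epsilon>) / 2))"
      by eventually_elim simp
    then obtain \<epsilon> where e: "\<epsilon> > 0" "c < ln (2 + exp ((\<mu> - \<epsilon>) / 2))"
      using eventually_happens'[OF trivial_limit_at_right_real] by blast
    obtain C where C: "C > 0"
      "\<And>m. m \<ge> 1 \<Longrightarrow> exp ((\<mu> - \<epsilon>) * real m) \<le> C * a m"
      by (rule exponential_bounds[OF pos lim e(1)]) blast+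
    have le: "ln (1 / C * touchard (\<lambda>m. exp ((\<mu> - \<epsilon>) * real m)) n) / real (n + 2) \<le> ln (touchard a n) / real (n + 2)" for n
    proof -
      have "touchard (\<lambda>m. exp ((\<mu> - \<epsilon>) * real m)) n \<le> C * touchard a n"
        unfolding touchard_cmult[symmetric] by (rule touchard_mono, rule C(2)) simp
      moreover have "touchard (\<lambda>m. exp ((\<mu> - \<epsilon>) * real m)) n > 0"
        by (rule touchard_pos) simp
      ultimately show ?thesis using C(1) by (intro divide_right_mono ln_mono) (auto simp: field_simps)
    qed
    have "\<forall>\<^sub>F n in sequentially. c < ln (1 / C * touchard (\<lambda>m. exp ((\<mu> - \<epsilon>) * real m)) n) / real (n + 2)"
      using order_tendstoD(1)[OF touchard_exp_growth[of "1 / C"] e(2)] C(1) by simp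
    then show "\<forall>\<^sub>F n in sequentially. c < ln (touchard a n) / real (n + 2)"
      by eventually_elim (rule less_le_trans[OF _ le])
  }
qed

section \<open>Exponential growth of the number of trees\<close>

lemma card_Omega_rec: "real (card (Omega (N + 2))) = touchard (\<lambda>m. real (card (Omega m))) N"
  using sum_Omega_prune[of "\<lambda>_. 1" N] by simp

lemma card_Omega_le: "real (card (Omega n)) \<le> 4 ^ n"
proof (induction n rule: less_induct)
  case (less n)
  consider "n = 0" | "n = 1" | N where "n = N + 2" by (metis One_nat_def add_2_eq_Suc' not0_implies_Suc)
  then show ?case
  proof cases
    case 3
    have "real (card (Omega n)) \<le> touchard (\<lambda>m. 4 ^ m) N"
      unfolding 3 card_Omega_rec by (intro touchard_mono less) (use 3 in auto)
    also have "\<dots> \<le> 2 * (4 ^ N + 1)" by (cases N) (simp_all add: touchard_power_4)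
    also have "\<dots> \<le> 2 * (4 ^ N + 4 ^ N)" by simp
    also have "\<dots> \<le> 16 * 4 ^ N" by simp
    also have "\<dots> = 4 ^ n" by (simp add: 3)
    finally show ?thesis .
  qed (auto simp: Omega_0 Omega_1)
qed

text \<open>Touchard's recursion at \<open>4 ^ m\<close> loses a factor 8, which the halving of the number of leaves
  recovers through the cube.\<close>
lemma card_Omega_ge: "n \<ge> 1 \<Longrightarrow> 4 ^ n / (4 * real n ^ 3) \<le> real (card (Omega n))"
proof (induction n rule: less_induct)
  case (less n)
  consider "n = 1" | N where "n = N + 2"
    using less.prems by (metis One_nat_def add_2_eq_Suc' not0_implies_Suc not_one_le_zero)
  then show ?case
  proof cases
    case 2
    \<comment> \<open>The constant \<open>2 / n^3\<close> is what Touchard's sum at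
      \<open>4 ^ m\<close> turns into the target:
      \<open>2 / n^3 * 2 * 4^N = 4^n / (4 * n^3)\<close>. It is at most
      \<open>1 / (4 * (j + 1)^3)\<close> because \<open>2 * (j + 1) \<le> n\<close>.\<close>
    have "4 ^ n / (4 * real n ^ 3) \<le> 2 / real n ^ 3 * touchard (\<lambda>m. 4 ^ m) N"
      using 2 by (simp add: touchard_power_4 field_simps)
    also have "\<dots> = touchard (\<lambda>m. 2 / real n ^ 3 * 4 ^ m) N"
      by (rule touchard_cmult[symmetric])
    also have "\<dots> \<le> touchard (\<lambda>m. real (card (Omega m))) N"
    proof (rule touchard_mono)
      fix j assume "2 * j \<le> N"
      then have "2 * real (Suc j) \<le> real n" using 2 by simp
      then have "(2 * real (Suc j)) ^ 3 \<le> real n ^ 3" by (intro power_mono) auto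
      then have "8 * real (Suc j) ^ 3 \<le> real n ^ 3" by (simp only: power_mult_distrib) simp
      then have "8 / real n ^ 3 \<le> 8 / (8 * real (Suc j) ^ 3)" by (intro divide_left_mono) (use 2 in auto)
      then have "2 / real n ^ 3 \<le> 1 / (4 * real (Suc j) ^ 3)" by simp
      then have "2 / real n ^ 3 * 4 ^ Suc j \<le> 1 / (4 * real (Suc j) ^ 3) * 4 ^ Suc j"
        by (intro mult_right_mono) auto
      also have "\<dots> \<le> real (card (Omega (Suc j)))"
        using less.IH[of "Suc j"] \<open>2 * j \<le> N\<close> 2 by simp
      finally show "2 / real n ^ 3 * 4 ^ Suc j \<le> real (card (Omega (Suc j)))" .
    qed
    finally show ?thesis unfolding 2 card_Omega_rec .
  qed (auto simp: Omega_1)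
qed

lemma ln_card_Omega_limit: "(\<lambda>n. ln (real (card (Omega n))) / real n) \<longlonglongrightarrow> ln 4"
proof (rule tendsto_sandwich)
  show "\<forall>\<^sub>F n in sequentially. (real n * ln 4 - ln (4 * real n ^ 3)) / real n \<le> ln (real (card (Omega n))) / real n"
    using eventually_ge_at_top[of 1]
  proof eventually_elim
    case (elim n)
    have "real n * ln 4 - ln (4 * real n ^ 3) = ln (4 ^ n / (4 * real n ^ 3))"
      using elim by (simp add: ln_div ln_realpow)
    also have "\<dots> \<le> ln (real (card (Omega n)))"
      using card_Omega_ge[OF elim] elim by (intro ln_mono) auto
    finally show ?case by (intro divide_right_mono) auto
  qed
  show "\<forall>\<^sub>F n in sequentially. ln (real (card (Omega n))) / real n \<le> ln 4"
    using eventually_ge_at_top[of 1]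
  proof eventually_elim
    case (elim n)
    have "ln (real (card (Omega n))) \<le> ln (4 ^ n)"
      using card_Omega_le[of n] card_Omega_pos[OF elim] by (intro ln_mono) auto
    then show ?case using elim by (simp add: ln_realpow field_simps)
  qed
  show "(\<lambda>n. (real n * ln 4 - ln (4 * real n ^ 3)) / real n) \<longlonglongrightarrow> ln 4" by real_asymp
qed simp

section \<open>From the transform to iterates of \<open>phi\<close>\<close>

lemma phi_eq: "phi x = ln ((1 + exp (x / 2)) / 2)"
proof -
  have "(1 + exp (x / 2)) / 2 = exp (x / 4) * cosh (x / 4)"
    by (simp add: cosh_field_def algebra_simps exp_add[symmetric])
  then show ?thesis by (simp add: phi_def ln_mult_pos)
qed

text \<open>The unnormalised moment generating function. The index \<open>r\<close> is the number of
  prunings that bring order \<open>r + 1\<close> down to order 1.\<close>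

definition partition_fun :: "nat \<Rightarrow> nat \<Rightarrow> real \<Rightarrow> real" where
  "partition_fun r n x = (\<Sum>t\<in>Omega n. exp (x * real (S (Suc r) t)))"

lemma partition_fun_pos: "n \<ge> 1 \<Longrightarrow> partition_fun r n x > 0"
  unfolding partition_fun_def by (intro sum_pos finite_Omega Omega_nonempty) auto

lemma partition_fun_Suc:
  "partition_fun (Suc r) (N + 2) x = touchard (\<lambda>m. partition_fun r m x) N"
proof -
  have "t \<noteq> Leaf" if "t \<in> Omega (N + 2)" for t using that by (auto simp: Omega_def)
  then have "partition_fun (Suc r) (N + 2) x = (\<Sum>t\<in>Omega (N + 2). exp (x * real (S (Suc r) (prune t))))"
    unfolding partition_fun_def by (intro sum.cong refl) (simp add: S_Suc_eq_S_prune)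
  then show ?thesis
    unfolding partition_fun_def using sum_Omega_prune[of "\<lambda>t. exp (x * real (S (Suc r) t))"] by simp
qed

text \<open>Without pruning the count is the constant \<open>n\<close>, giving rate
  \<open>x + ln 4\<close>. Each pruning sends a rate \<open>\<mu>\<close> to
  \<open>ln (2 + exp (\<mu> / 2))\<close>, which is \<open>phi\<close> after subtracting
  \<open>ln 4\<close> on both sides.\<close>

lemma partition_fun_limit: "(\<lambda>n. ln (partition_fun r n x) / real n) \<longlonglongrightarrow> (phi ^^ r) x + ln 4"
proof (induction r)
  case 0
  have "\<forall>\<^sub>F n in sequentially. x + ln (real (card (Omega n))) / real n = ln (partition_fun 0 n x) / real n"
    using eventually_ge_at_top[of 1]
  proof eventually_elim
    case (elim n)
    have "partition_fun 0 n x = (\<Sum>t\<in>Omega n. exp (x * real n))"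
      unfolding partition_fun_def S_1_eq_leaves by (intro sum.cong) (auto simp: Omega_def)
    then have "ln (partition_fun 0 n x) = ln (real (card (Omega n))) + x * real n"
      using card_Omega_pos[OF elim] by (simp add: ln_mult_pos)
    then show ?case using elim by (simp add: field_simps)
  qed
  moreover have "(\<lambda>n. x + ln (real (card (Omega n))) / real n) \<longlonglongrightarrow> x + ln 4"
    by (intro tendsto_intros ln_card_Omega_limit)
  ultimately show ?case by (simp add: tendsto_cong)
next
  case (Suc r)
  have "(\<lambda>n. ln (partition_fun (Suc r) (n + 2) x) / real (n + 2))
      \<longlonglongrightarrow> ln (2 + exp (((phi ^^ r) x + ln 4) / 2))"
    unfolding partition_fun_Suc by (rule touchard_growth[OF partition_fun_pos Suc])
  \<comment> \<open>Since \<open>exp (ln 4 / 2) = 2\<close>, a factor 4 splits off and leaves the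
    argument of \<open>ln\<close> in \<open>phi_eq\<close>.\<close>
  moreover have "2 + exp (((phi ^^ r) x + ln 4) / 2) = 4 * ((1 + exp ((phi ^^ r) x / 2)) / 2)"
  proof -
    have "exp (ln 4 / 2) = (2::real)"
      using ln_realpow[of "2::real" 2] by simp
    then show ?thesis by (simp add: add_divide_distrib exp_add)
  qed
  moreover have "ln (4 * ((1 + exp ((phi ^^ r) x / 2)) / 2)) = ln 4 + phi ((phi ^^ r) x)"
    unfolding phi_eq by (rule ln_mult_pos) (auto simp: add_pos_pos)
  ultimately have "(\<lambda>n. ln (partition_fun (Suc r) (n + 2) x) / real (n + 2)) \<longlonglongrightarrow> phi ((phi ^^ r) x) + ln 4"
    by (simp add: add.commute)
  then have "(\<lambda>n. ln (partition_fun (Suc r) n x) / real n) \<longlonglongrightarrow> phi ((phi ^^ r) x) + ln 4"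
    by (rule LIMSEQ_offset)
  then show ?case by simp
qed

section \<open>Large deviations from the logarithmic moment generating function\<close>

lemma exponential_rate_bounds:
  fixes M :: "nat \<Rightarrow> real"
  assumes pos: "\<forall>\<^sub>F n in sequentially. M n > 0"
    and lim: "(\<lambda>n. ln (M n) / real n) \<longlonglongrightarrow> l" and e: "e > 0"
  shows "\<forall>\<^sub>F n in sequentially. M n \<le> exp (real n * (l + e))"
    and "\<forall>\<^sub>F n in sequentially. exp (real n * (l - e)) \<le> M n"
proof -
  have up: "\<forall>\<^sub>F n in sequentially. ln (M n) / real n < l + e"
    and lo: "\<forall>\<^sub>F n in sequentially. l - e < ln (M n) / real n"
    using order_tendstoD[OF lim] e by auto
  show "\<forall>\<^sub>F n in sequentially. M n \<le> exp (real n * (l + e))"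
    using up pos eventually_gt_at_top[of 0]
  proof eventually_elim
    case (elim n)
    then have "ln (M n) \<le> real n * (l + e)" by (simp add: field_simps)
    then show ?case using elim by (metis exp_le_cancel_iff exp_ln)
  qed
  show "\<forall>\<^sub>F n in sequentially. exp (real n * (l - e)) \<le> M n"
    using lo pos eventually_gt_at_top[of 0]
  proof eventually_elim
    case (elim n)
    then have "real n * (l - e) \<le> ln (M n)" by (simp add: field_simps)
    then show ?case using elim by (metis exp_le_cancel_iff exp_ln)
  qed
qed

text \<open>Under the tilt by \<open>x1\<close>, changing the tilt to \<open>x0\<close> and to \<open>x2\<close> shows that the mass below
  \<open>n * F' x0\<close> and above \<open>n * F' x2\<close> is exponentially negligible.\<close>
lemma gaertner_ellis_lower_bound:
  fixes X :: "'a \<Rightarrow> real" and A :: "nat \<Rightarrow> 'a set" and F F' :: "real \<Rightarrow> real"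
  defines "M \<equiv> \<lambda>n x. (\<Sum>t\<in>A n. exp (x * X t)) / real (card (A n))"
  assumes fin: "\<And>n. finite (A n)"
    and ne: "\<forall>\<^sub>F n in sequentially. A n \<noteq> {}"
    and lim: "\<And>x. (\<lambda>n. ln (M n x) / real n) \<longlonglongrightarrow> F x"
    and tangent: "\<And>x z. x \<noteq> z \<Longrightarrow> F z + F' z * (x - z) < F x"
    and x: "0 \<le> x0" "x0 < x1" "x1 < x2" and d: "d > 0"
  shows "\<forall>\<^sub>F n in sequentially. exp (real n * (F x1 - x1 * F' x2 - d)) \<le>
      real (card {t \<in> A n. X t > real n * F' x0}) / real (card (A n))"
proof -
  \<comment> \<open>By strict convexity both tails have an exponential rate below
    \<open>F x1\<close> by at least \<open>gap\<close>.\<close>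
  define gap where "gap = min (F x1 - (F x0 + F' x0 * (x1 - x0))) (F x1 - (F x2 + F' x2 * (x1 - x2)))"
  have gap: "gap > 0" using tangent[of x1 x0] tangent[of x1 x2] x by (simp add: gap_def)
  have gap_le: "gap \<le> F x1 - (F x0 + F' x0 * (x1 - x0))" "gap \<le> F x1 - (F x2 + F' x2 * (x1 - x2))"
    by (simp_all add: gap_def)
  \<comment> \<open>With \<open>4 * e \<le> gap\<close>, each tail still loses a factor
    \<open>exp (- n * e)\<close> after the errors in both rates; with \<open>2 * e \<le> d\<close>,
    the final estimate stays within \<open>d\<close>.\<close>
  define e where "e = min (gap / 4) (d / 2)"
  have e: "e > 0" "e \<le> gap / 4" "e \<le> d / 2" using gap d by (auto simp: e_def)
  have Mpos: "\<forall>\<^sub>F n in sequentially. M n x > 0" for x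
    using ne by eventually_elim (auto simp: M_def card_gt_0_iff fin intro!: divide_pos_pos sum_pos)
  have small: "\<forall>\<^sub>F n in sequentially. exp (real n * - e) \<le> 1 / 4"
    using e(1) by real_asymp
  have sum_Un_le: "(\<Sum>t\<in>P \<union> Q. exp (x1 * X t)) \<le> (\<Sum>t\<in>P. exp (x1 * X t)) + (\<Sum>t\<in>Q. exp (x1 * X t))"
    if "finite P" "finite Q" for P Q
    using that by (subst sum_Un) (auto intro: sum_nonneg)
  show ?thesis
    using exponential_rate_bounds(2)[OF Mpos[of x1] lim[of x1] e(1)]
      exponential_rate_bounds(1)[OF Mpos[of x0] lim[of x0] e(1)]
      exponential_rate_bounds(1)[OF Mpos[of x2] lim[of x2] e(1)] small ne
  proof eventually_elim
    case (elim n)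
    let ?c = "real (card (A n))"
    let ?N = "real n"
    let ?L = "{t \<in> A n. X t \<le> ?N * F' x0}" and ?H = "{t \<in> A n. X t \<ge> ?N * F' x2}"
    let ?G = "{t \<in> A n. X t > ?N * F' x0}"
    let ?B = "{t \<in> A n. X t > ?N * F' x0 \<and> X t < ?N * F' x2}"
    have c: "?c > 0" using elim(5) fin by (simp add: card_gt_0_iff)
    \<comment> \<open>Exponential Chebyshev bound: on \<open>?L\<close> the quantity
      \<open>(x1 - x0) * (X t - n * F' x0)\<close> is nonpositive, so the tilt can be lowered to
      \<open>x0\<close>. On \<open>?H\<close> the tilt is raised to \<open>x2\<close> in the same
      way.\<close>
    have "(\<Sum>t\<in>?L. exp (x1 * X t)) \<le> (\<Sum>t\<in>?L. exp ((x1 - x0) * (?N * F' x0)) * exp (x0 * X t))"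
    proof (rule sum_mono)
      fix t assume "t \<in> ?L"
      then have "(x1 - x0) * X t \<le> (x1 - x0) * (?N * F' x0)" using x by (intro mult_left_mono) auto
      then show "exp (x1 * X t) \<le> exp ((x1 - x0) * (?N * F' x0)) * exp (x0 * X t)"
        by (simp add: exp_add[symmetric] algebra_simps)
    qed
    also have "\<dots> \<le> (\<Sum>t\<in>A n. exp ((x1 - x0) * (?N * F' x0)) * exp (x0 * X t))"
      using fin by (intro sum_mono2) auto
    also have "\<dots> = exp ((x1 - x0) * (?N * F' x0)) * M n x0 * ?c"
      using c by (simp add: M_def sum_distrib_left)
    also have "\<dots> \<le> exp ((x1 - x0) * (?N * F' x0)) * exp (?N * (F x0 + e)) * ?c"
      using elim(2) by (intro mult_right_mono mult_left_mono) auto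
    also have "exp ((x1 - x0) * (?N * F' x0)) * exp (?N * (F x0 + e)) = exp (?N * (F x0 + F' x0 * (x1 - x0) + e))"
      by (simp add: exp_add[symmetric] algebra_simps)
    also have "\<dots> \<le> exp (?N * ((F x1 - e) + - e))"
      by (subst exp_le_cancel_iff, intro mult_left_mono) (use e(1,2) gap_le in linarith, simp)
    also have "\<dots> \<le> exp (?N * (F x1 - e)) * (1 / 4)"
      unfolding distrib_left exp_add using elim(4) by (intro mult_left_mono) auto
    finally have L: "(\<Sum>t\<in>?L. exp (x1 * X t)) \<le> exp (?N * (F x1 - e)) * (1 / 4) * ?c"
      using c by simp
    have "(\<Sum>t\<in>?H. exp (x1 * X t)) \<le> (\<Sum>t\<in>?H. exp ((x1 - x2) * (?N * F' x2)) * exp (x2 * X t))"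
    proof (rule sum_mono)
      fix t assume "t \<in> ?H"
      then have "(x2 - x1) * (?N * F' x2) \<le> (x2 - x1) * X t" using x by (intro mult_left_mono) auto
      then show "exp (x1 * X t) \<le> exp ((x1 - x2) * (?N * F' x2)) * exp (x2 * X t)"
        by (simp add: exp_add[symmetric] algebra_simps)
    qed
    also have "\<dots> \<le> (\<Sum>t\<in>A n. exp ((x1 - x2) * (?N * F' x2)) * exp (x2 * X t))"
      using fin by (intro sum_mono2) auto
    also have "\<dots> = exp ((x1 - x2) * (?N * F' x2)) * M n x2 * ?c"
      using c by (simp add: M_def sum_distrib_left)
    also have "\<dots> \<le> exp ((x1 - x2) * (?N * F' x2)) * exp (?N * (F x2 + e)) * ?c"
      using elim(3) by (intro mult_right_mono mult_left_mono) auto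
    also have "exp ((x1 - x2) * (?N * F' x2)) * exp (?N * (F x2 + e)) = exp (?N * (F x2 + F' x2 * (x1 - x2) + e))"
      by (simp add: exp_add[symmetric] algebra_simps)
    also have "\<dots> \<le> exp (?N * ((F x1 - e) + - e))"
      by (subst exp_le_cancel_iff, intro mult_left_mono) (use e(1,2) gap_le in linarith, simp)
    also have "\<dots> \<le> exp (?N * (F x1 - e)) * (1 / 4)"
      unfolding distrib_left exp_add using elim(4) by (intro mult_left_mono) auto
    finally have H: "(\<Sum>t\<in>?H. exp (x1 * X t)) \<le> exp (?N * (F x1 - e)) * (1 / 4) * ?c"
      using c by simp
    \<comment> \<open>In the middle window the tilted weight is at most
      \<open>exp (n * x1 * F' x2)\<close> because \<open>x1 > 0\<close>, so tilted mass converts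
      into a count.\<close>
    have B: "(\<Sum>t\<in>?B. exp (x1 * X t)) \<le> real (card ?G) * exp (?N * (x1 * F' x2))"
    proof -
      have "(\<Sum>t\<in>?B. exp (x1 * X t)) \<le> (\<Sum>t\<in>?B. exp (?N * (x1 * F' x2)))"
      proof (rule sum_mono)
        fix t assume "t \<in> ?B"
        then have "x1 * X t \<le> x1 * (?N * F' x2)" using x by (intro mult_left_mono) auto
        then show "exp (x1 * X t) \<le> exp (?N * (x1 * F' x2))" by (simp add: mult_ac)
      qed
      also have "\<dots> \<le> (\<Sum>t\<in>?G. exp (?N * (x1 * F' x2)))"
        using fin by (intro sum_mono2) auto
      finally show ?thesis by simp
    qed
    have "exp (?N * (F x1 - e)) * ?c \<le> (\<Sum>t\<in>A n. exp (x1 * X t))"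
      using elim(1) c by (simp add: M_def field_simps)
    also have "\<dots> \<le> (\<Sum>t\<in>?L \<union> (?H \<union> ?B). exp (x1 * X t))"
      using fin by (intro sum_mono2) auto
    also have "\<dots> \<le> (\<Sum>t\<in>?L. exp (x1 * X t)) + (\<Sum>t\<in>?H \<union> ?B. exp (x1 * X t))"
      using fin by (intro sum_Un_le) auto
    also have "(\<Sum>t\<in>?H \<union> ?B. exp (x1 * X t)) \<le> (\<Sum>t\<in>?H. exp (x1 * X t)) + (\<Sum>t\<in>?B. exp (x1 * X t))"
      using fin by (intro sum_Un_le) auto
    \<comment> \<open>Each tail takes at most a quarter of the lower bound for the total, so at
      least half remains in the window.\<close>
    finally have "exp (?N * (F x1 - e)) * ?c / 2 \<le> real (card ?G) * exp (?N * (x1 * F' x2))"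
      using L H B by simp
    then have "exp (?N * (F x1 - e)) / 2 / exp (?N * (x1 * F' x2)) \<le> real (card ?G) / ?c"
      using c by (simp add: field_simps)
    moreover have "exp (?N * (F x1 - x1 * F' x2 - d)) \<le> exp (?N * (F x1 - e)) / 2 / exp (?N * (x1 * F' x2))"
    proof -
      have "?N * (F x1 - x1 * F' x2 - d) \<le> ?N * (F x1 - e - x1 * F' x2 + - e)"
        using e(3) by (intro mult_left_mono) auto
      then have "exp (?N * (F x1 - x1 * F' x2 - d)) \<le> exp (?N * (F x1 - e - x1 * F' x2)) * exp (?N * - e)"
        unfolding exp_add[symmetric] distrib_left[symmetric] by simp
      also have "\<dots> \<le> exp (?N * (F x1 - e - x1 * F' x2)) * (1 / 2)"
        using elim(4) by (intro mult_left_mono) auto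
      also have "\<dots> = exp (?N * (F x1 - e)) / 2 / exp (?N * (x1 * F' x2))"
        by (simp add: right_diff_distrib exp_diff)
      finally show ?thesis .
    qed
    ultimately show ?case by linarith
  qed
qed

text \<open>The upper estimate is Chernoff's bound with tilt \<open>x0\<close>. The lower one tilts
  slightly beyond \<open>x0\<close>, so that the tilted mass concentrates just above the
  threshold.\<close>

lemma gaertner_ellis_upper_tail:
  fixes X :: "'a \<Rightarrow> real" and A :: "nat \<Rightarrow> 'a set" and F F' :: "real \<Rightarrow> real"
  defines "M \<equiv> \<lambda>n x. (\<Sum>t\<in>A n. exp (x * X t)) / real (card (A n))"
  assumes fin: "\<And>n. finite (A n)"
    and ne: "\<forall>\<^sub>F n in sequentially. A n \<noteq> {}"
    and lim: "\<And>x. (\<lambda>n. ln (M n x) / real n) \<longlonglongrightarrow> F x"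
    and tangent: "\<And>x z. x \<noteq> z \<Longrightarrow> F z + F' z * (x - z) < F x"
    and cont: "isCont F x0" "isCont F' x0" and x0: "0 \<le> x0"
  shows "(\<lambda>n. ln (real (card {t \<in> A n. X t > real n * F' x0}) / real (card (A n))) / real n)
      \<longlonglongrightarrow> F x0 - x0 * F' x0"
proof -
  let ?P = "\<lambda>n. real (card {t \<in> A n. X t > real n * F' x0}) / real (card (A n))"
  have lower: "\<forall>\<^sub>F n in sequentially. exp (real n * c) \<le> ?P n" if c: "c < F x0 - x0 * F' x0" for c
  proof -
    \<comment> \<open>The tilts are \<open>x0\<close>, \<open>x0 + h\<close> and
      \<open>x0 + 2 * h\<close>, with \<open>h\<close> also serving as the error \<open>d\<close>;
      continuity of \<open>F\<close> and \<open>F'\<close> recovers the exact rate as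
      \<open>h\<close> tends to 0.\<close>
    have "((\<lambda>h. F (x0 + h) - (x0 + h) * F' (x0 + 2 * h) - h) \<longlongrightarrow>
        F (x0 + 0) - (x0 + 0) * F' (x0 + 2 * 0) - 0) (at_right 0)"
      using cont by (intro tendsto_intros isCont_tendsto_compose[of _ F] isCont_tendsto_compose[of _ F']) auto
    then have "\<forall>\<^sub>F h in at_right 0. c < F (x0 + h) - (x0 + h) * F' (x0 + 2 * h) - h"
      by (rule order_tendstoD) (use c in simp)
    moreover have "\<forall>\<^sub>F h in at_right 0. (h::real) > 0" by (simp add: eventually_at_right_less)
    ultimately have "\<forall>\<^sub>F h in at_right 0. 0 < h \<and> c < F (x0 + h) - (x0 + h) * F' (x0 + 2 * h) - h"
      by eventually_elim simp
    then obtain h where h: "h > 0" "c < F (x0 + h) - (x0 + h) * F' (x0 + 2 * h) - h"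
      using eventually_happens'[OF trivial_limit_at_right_real] by blast
    have "\<forall>\<^sub>F n in sequentially. exp (real n * (F (x0 + h) - (x0 + h) * F' (x0 + 2 * h) - h)) \<le> ?P n"
      using h(1) x0 by (intro gaertner_ellis_lower_bound fin ne lim[unfolded M_def] tangent) auto
    then show ?thesis
    proof eventually_elim
      case (elim n)
      have "real n * c \<le> real n * (F (x0 + h) - (x0 + h) * F' (x0 + 2 * h) - h)"
        using h(2) by (intro mult_left_mono) auto
      then show ?case using elim by (meson exp_le_cancel_iff order_trans)
    qed
  qed
  have Mpos: "\<forall>\<^sub>F n in sequentially. M n x > 0" for x
    using ne by eventually_elim (auto simp: M_def card_gt_0_iff fin intro!: divide_pos_pos sum_pos)
  have upper: "\<forall>\<^sub>F n in sequentially. ?P n \<le> exp (real n * (F x0 - x0 * F' x0 + e))" if e: "e > 0" for e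
    using exponential_rate_bounds(1)[OF Mpos lim e, of x0] ne
  proof eventually_elim
    case (elim n)
    have c: "real (card (A n)) > 0" using elim(2) fin by (simp add: card_gt_0_iff)
    have "real (card {t \<in> A n. X t > real n * F' x0}) * exp (x0 * (real n * F' x0)) =
        (\<Sum>t\<in>{t \<in> A n. X t > real n * F' x0}. exp (x0 * (real n * F' x0)))" by simp
    also have "\<dots> \<le> (\<Sum>t\<in>{t \<in> A n. X t > real n * F' x0}. exp (x0 * X t))"
      using x0 by (intro sum_mono) (auto intro: mult_left_mono)
    also have "\<dots> \<le> (\<Sum>t\<in>A n. exp (x0 * X t))" using fin by (intro sum_mono2) auto
    also have "\<dots> = M n x0 * real (card (A n))" using c by (simp add: M_def)
    also have "\<dots> \<le> exp (real n * (F x0 + e)) * real (card (A n))"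
      using elim(1) c by (intro mult_right_mono) auto
    finally have "?P n \<le> exp (real n * (F x0 + e)) / exp (x0 * (real n * F' x0))"
      using c by (simp add: field_simps)
    also have "\<dots> = exp (real n * (F x0 - x0 * F' x0 + e))"
      by (simp add: exp_diff[symmetric] algebra_simps)
    finally show ?case .
  qed
  show ?thesis
  proof (rule order_tendstoI)
    fix c assume "c < F x0 - x0 * F' x0"
    then obtain c' where c': "c < c'" "c' < F x0 - x0 * F' x0" using dense by blast
    show "\<forall>\<^sub>F n in sequentially. c < ln (?P n) / real n"
      using lower[OF c'(2)] eventually_gt_at_top[of 0]
    proof eventually_elim
      case (elim n)
      have "ln (exp (real n * c')) \<le> ln (?P n)" using elim(1) by (intro ln_mono) auto
      then have "c' \<le> ln (?P n) / real n" using elim(2) by (simp add: field_simps)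
      then show ?case using c' by simp
    qed
  next
    fix c assume "F x0 - x0 * F' x0 < c"
    then obtain c' where c': "F x0 - x0 * F' x0 < c'" "c' < c" using dense by blast
    define e where "e = c' - (F x0 - x0 * F' x0)"
    have e: "e > 0" "F x0 - x0 * F' x0 + e = c'" using c' by (auto simp: e_def)
    \<comment> \<open>Any rate below the limit will do: the lower estimate serves only to make
      \<open>?P n\<close> positive, so that \<open>ln\<close> is monotone there.\<close>
    have "F x0 - x0 * F' x0 - 1 < F x0 - x0 * F' x0" by simp
    from upper[OF e(1)] lower[OF this] eventually_gt_at_top[of 0]
    show "\<forall>\<^sub>F n in sequentially. ln (?P n) / real n < c"
    proof eventually_elim
      case (elim n)
      have "?P n > 0" using elim(2) by (rule less_le_trans[OF exp_gt_zero])
      then have "ln (?P n) \<le> ln (exp (real n * c'))" using elim(1) unfolding e(2) by (intro ln_mono) auto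
      then have "ln (?P n) / real n \<le> c'" using elim(3) by (simp add: field_simps)
      then show ?case using c' by simp
    qed
  qed
qed

section \<open>Convexity of the iterates of phi\<close>

definition dphi :: "real \<Rightarrow> real" where
  "dphi x = 1 / 4 + tanh (x / 4) / 4"

lemma has_derivative_phi: "(phi has_real_derivative dphi x) (at x)"
  unfolding phi_def dphi_def
  by (auto intro!: derivative_eq_intros simp: tanh_def field_simps)

lemma dphi_bounds: "0 < dphi x" "dphi x < 1 / 2"
  using tanh_real_bounds[of "x / 4"] by (auto simp: dphi_def)

lemma dphi_strict_mono: "x < y \<Longrightarrow> dphi x < dphi y"
  by (simp add: dphi_def)

lemma isCont_dphi: "isCont dphi x"
  unfolding dphi_def by (intro continuous_intros) auto

lemma phi_strict_mono: "x < y \<Longrightarrow> phi x < phi y"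
  using DERIV_pos_imp_increasing[of x y phi] has_derivative_phi dphi_bounds(1) by blast

lemma phi_0: "phi 0 = 0"
  by (simp add: phi_def)

fun dphi_iter :: "nat \<Rightarrow> real \<Rightarrow> real" where
  "dphi_iter 0 x = 1"
| "dphi_iter (Suc r) x = dphi ((phi ^^ r) x) * dphi_iter r x"

lemma has_derivative_phi_iter: "((phi ^^ r) has_real_derivative dphi_iter r x) (at x)"
proof (induction r)
  case (Suc r)
  have "((\<lambda>x. phi ((phi ^^ r) x)) has_real_derivative dphi ((phi ^^ r) x) * dphi_iter r x) (at x)"
    by (rule DERIV_chain2[OF has_derivative_phi Suc])
  then show ?case by (simp add: comp_def)
qed (simp add: id_def)

lemma phi_iter_strict_mono: "x < y \<Longrightarrow> (phi ^^ r) x < (phi ^^ r) y"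
  by (induction r) (auto simp: phi_strict_mono)

lemma phi_iter_0: "(phi ^^ r) 0 = 0"
  by (induction r) (auto simp: phi_0)

lemma dphi_iter_pos: "dphi_iter r x > 0"
  by (induction r) (auto simp: dphi_bounds)

lemma dphi_iter_0: "dphi_iter r 0 = 1 / 4 ^ r"
  by (induction r) (auto simp: phi_iter_0 dphi_def)

lemma isCont_phi_iter: "isCont (phi ^^ r) x"
  using has_derivative_phi_iter by (rule DERIV_isCont)

lemma isCont_dphi_iter: "isCont (dphi_iter r) x"
proof (induction r)
  case (Suc r)
  have "isCont (\<lambda>x. dphi ((phi ^^ r) x)) x"
    using isCont_o2[OF isCont_phi_iter isCont_dphi] .
  then have "isCont (\<lambda>x. dphi ((phi ^^ r) x) * dphi_iter r x) x"
    using Suc by (intro continuous_intros)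
  then show ?case by (simp add: dphi_iter.simps(2)[abs_def])
qed (simp add: dphi_iter.simps(1)[abs_def])

lemma dphi_iter_mono: "x \<le> y \<Longrightarrow> dphi_iter r x \<le> dphi_iter r y"
proof (induction r)
  case (Suc r)
  have "dphi ((phi ^^ r) x) \<le> dphi ((phi ^^ r) y)"
    using Suc.prems dphi_strict_mono[OF phi_iter_strict_mono[of x y r]] by (cases "x = y") auto
  then show ?case
    using Suc dphi_iter_pos[of r x] dphi_bounds(1)[of "(phi ^^ r) y"]
    by (auto intro!: mult_mono simp: less_imp_le)
qed auto

text \<open>Strictness comes from the outermost factor, the remaining product being positive and
  nondecreasing. For \<open>r = 0\<close> the slope is constantly 1.\<close>

lemma dphi_iter_strict_mono:
  assumes "r \<ge> 1" "x < y"
  shows "dphi_iter r x < dphi_iter r y"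
proof -
  obtain k where r: "r = Suc k" using assms(1) by (cases r) auto
  have "dphi ((phi ^^ k) x) * dphi_iter k x < dphi ((phi ^^ k) y) * dphi_iter k x"
    using dphi_strict_mono[OF phi_iter_strict_mono[OF assms(2)]] dphi_iter_pos by (intro mult_strict_right_mono)
  also have "\<dots> \<le> dphi ((phi ^^ k) y) * dphi_iter k y"
    using dphi_iter_mono[of x y k] assms(2) dphi_bounds(1) by (intro mult_left_mono) (auto simp: less_imp_le)
  finally show ?thesis by (simp add: r)
qed

text \<open>Strict convexity via the mean value theorem: the secant slope is attained strictly
  between \<open>z\<close> and \<open>x\<close>, where the derivative differs strictly from that at
  \<open>z\<close>.\<close>

lemma phi_iter_above_tangent:
  assumes "r \<ge> 1" "x \<noteq> z"
  shows "(phi ^^ r) z + dphi_iter r z * (x - z) < (phi ^^ r) x"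
proof (cases "z < x")
  case True
  obtain w where w: "z < w" "w < x" "(phi ^^ r) x - (phi ^^ r) z = (x - z) * dphi_iter r w"
    using MVT2[OF True has_derivative_phi_iter] by blast
  have "dphi_iter r z * (x - z) < dphi_iter r w * (x - z)"
    using dphi_iter_strict_mono[OF assms(1) w(1)] True by (intro mult_strict_right_mono) auto
  then show ?thesis using w(3) by (simp add: mult.commute)
next
  case False
  then have less: "x < z" using assms(2) by simp
  obtain w where w: "x < w" "w < z" "(phi ^^ r) z - (phi ^^ r) x = (z - x) * dphi_iter r w"
    using MVT2[OF less has_derivative_phi_iter] by blast
  have "dphi_iter r w * (z - x) < dphi_iter r z * (z - x)"
    using dphi_iter_strict_mono[OF assms(1) w(2)] less by (intro mult_strict_right_mono) auto
  then show ?thesis using w(3) by (simp add: algebra_simps)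
qed

text \<open>Lying above the tangent at \<open>z\<close> means exactly that the Legendre supremum for
  that slope is attained at \<open>z\<close>.\<close>

lemma rate_eq:
  assumes "r \<ge> 1"
  shows "rate r (dphi_iter r z) = z * dphi_iter r z - (phi ^^ r) z"
  unfolding rate_def
proof (rule cSup_eq_maximum)
  show "z * dphi_iter r z - (phi ^^ r) z \<in> range (\<lambda>\<xi>. dphi_iter r z * \<xi> - (phi ^^ r) \<xi>)"
    by (rule range_eqI[of _ _ z]) (simp add: mult.commute)
  fix u assume "u \<in> range (\<lambda>\<xi>. dphi_iter r z * \<xi> - (phi ^^ r) \<xi>)"
  then obtain x where u: "u = dphi_iter r z * x - (phi ^^ r) x" by blast
  show "u \<le> z * dphi_iter r z - (phi ^^ r) z"
    using phi_iter_above_tangent[OF assms, of x z] unfolding u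
    by (cases "x = z") (auto simp: algebra_simps)
qed

section \<open>The range of slopes\<close>

lemma phi_iter_at_top: "filterlim (phi ^^ r) at_top at_top"
proof (induction r)
  case 0
  then show ?case by (simp add: filterlim_ident id_def)
next
  case (Suc r)
  have "filterlim phi at_top at_top"
    unfolding phi_eq[abs_def] by real_asymp
  then show ?case using filterlim_compose[OF _ Suc] by (simp add: comp_def)
qed

lemma dphi_at_top: "(dphi \<longlongrightarrow> 1 / 2) at_top"
  unfolding dphi_def tanh_real_altdef by real_asymp

lemma dphi_at_bot: "(dphi \<longlongrightarrow> 0) at_bot"
  unfolding dphi_def tanh_real_altdef by real_asymp

lemma dphi_iter_at_top: "(dphi_iter r \<longlongrightarrow> 1 / 2 ^ r) at_top"
proof (induction r)
  case (Suc r)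
  have "((\<lambda>x. dphi ((phi ^^ r) x) * dphi_iter r x) \<longlongrightarrow> 1 / 2 * (1 / 2 ^ r)) at_top"
    using filterlim_compose[OF dphi_at_top phi_iter_at_top] Suc by (intro tendsto_mult)
  then show ?case by (simp add: dphi_iter.simps(2)[abs_def])
qed (simp add: dphi_iter.simps(1)[abs_def])

text \<open>Only the innermost factor \<open>dphi x\<close> tends to 0, since \<open>phi\<close> has
  a finite limit at minus infinity; the outer factors are merely bounded by 1. With no factor at all
  the slope would be 1, hence \<open>Suc r\<close>.\<close>

lemma dphi_iter_at_bot: "(dphi_iter (Suc r) \<longlongrightarrow> 0) at_bot"
proof (induction r)
  case 0
  then show ?case using dphi_at_bot by (simp add: dphi_iter.simps[abs_def])
next
  case (Suc r)
  show ?case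
  proof (rule tendsto_sandwich[OF _ _ tendsto_const Suc])
    show "\<forall>\<^sub>F x in at_bot. 0 \<le> dphi_iter (Suc (Suc r)) x"
      using dphi_iter_pos by (intro always_eventually allI less_imp_le)
    have "dphi_iter (Suc (Suc r)) x \<le> 1 * dphi_iter (Suc r) x" for x
      using dphi_iter_pos[of "Suc r" x] dphi_bounds[of "(phi ^^ Suc r) x"]
      unfolding dphi_iter.simps(2)[of "Suc r"] by (intro mult_right_mono) linarith+
    then show "\<forall>\<^sub>F x in at_bot. dphi_iter (Suc (Suc r)) x \<le> dphi_iter (Suc r) x"
      by (intro always_eventually allI) simp
  qed
qed

text \<open>The intermediate value theorem starting at 0, where the slope is
  \<open>1 / 4 ^ r\<close>. The sign of \<open>z\<close> is what Chernoff's bound for an upper tail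
  requires.\<close>

lemma dphi_iter_attains_upper:
  assumes "1 / 4 ^ r < y" "y < 1 / 2 ^ r"
  obtains z where "z \<ge> 0" "dphi_iter r z = y"
proof -
  have "\<forall>\<^sub>F x in at_top. y < dphi_iter r x \<and> x > 0"
    using order_tendstoD(1)[OF dphi_iter_at_top assms(2)] eventually_gt_at_top[of "0::real"]
    by eventually_elim simp
  then obtain b where b: "y < dphi_iter r b" "b > 0"
    using eventually_happens'[OF trivial_limit_at_top_linorder] by blast
  have "\<exists>z\<ge>0. z \<le> b \<and> dphi_iter r z = y"
    using assms(1) b isCont_dphi_iter by (intro IVT) (auto simp: dphi_iter_0)
  then show ?thesis using that by blast
qed

lemma dphi_iter_attains_lower:
  assumes "r \<ge> 1" "0 < y" "y < 1 / 4 ^ r"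
  obtains z where "z \<le> 0" "dphi_iter r z = y"
proof -
  obtain k where r: "r = Suc k" using assms(1) by (cases r) auto
  have "\<forall>\<^sub>F x in at_bot. dphi_iter r x < y \<and> x < 0"
    using order_tendstoD(2)[OF dphi_iter_at_bot[of k] assms(2)] eventually_gt_at_bot[of "0::real"]
    unfolding r by eventually_elim simp
  then obtain b where b: "dphi_iter r b < y" "b < 0"
    using eventually_happens'[OF trivial_limit_at_bot_linorder] by blast
  have "\<exists>z\<ge>b. z \<le> 0 \<and> dphi_iter r z = y"
    using assms b isCont_dphi_iter by (intro IVT) (auto simp: dphi_iter_0)
  then show ?thesis using that by blast
qed

section \<open>The tails of the branch numbers\<close>

text \<open>Dividing by the number of trees removes the summand \<open>ln 4\<close> from the
  rate.\<close>

lemma log_mgf_limit: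
  "(\<lambda>n. ln ((\<Sum>t\<in>Omega n. exp (x * real (S (Suc r) t))) / real (card (Omega n))) / real n)
     \<longlonglongrightarrow> (phi ^^ r) x"
proof -
  have "(\<lambda>n. ln (partition_fun r n x) / real n - ln (real (card (Omega n))) / real n)
      \<longlonglongrightarrow> ((phi ^^ r) x + ln 4) - ln 4"
    by (intro tendsto_diff partition_fun_limit ln_card_Omega_limit)
  moreover have "\<forall>\<^sub>F n in sequentially.
      ln (partition_fun r n x) / real n - ln (real (card (Omega n))) / real n =
      ln (partition_fun r n x / real (card (Omega n))) / real n"
    using eventually_ge_at_top[of 1]
  proof eventually_elim
    case (elim n)
    then show ?case
      using partition_fun_pos[of n r x] card_Omega_pos[of n] by (simp add: ln_div diff_divide_distrib)
  qed
  ultimately show ?thesis by (simp add: tendsto_cong partition_fun_def)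
qed

lemma Omega_eventually_nonempty: "\<forall>\<^sub>F n in sequentially. Omega n \<noteq> {}"
  using eventually_ge_at_top[of 1] by eventually_elim (rule Omega_nonempty)

theorem theorem2p2:
  fixes r :: nat
  assumes "r \<ge> 1"
  shows "(\<forall>y::real. 1 / 4 ^ r < y \<and> y < 1 / 2 ^ r \<longrightarrow>
            (\<lambda>n. ln (Prob n (\<lambda>t. real (S (r + 1) t) / real n > y)) / real n)
              \<longlonglongrightarrow> - rate r y)
       \<and> (\<forall>y::real. 0 < y \<and> y < 1 / 4 ^ r \<longrightarrow>
            (\<lambda>n. ln (Prob n (\<lambda>t. real (S (r + 1) t) / real n < y)) / real n)
              \<longlonglongrightarrow> - rate r y)"
proof (intro conjI allI impI; elim conjE)
  fix y :: real assume y: "1 / 4 ^ r < y" "y < 1 / 2 ^ r"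
  obtain z where z: "z \<ge> 0" "dphi_iter r z = y" using dphi_iter_attains_upper[OF y] .
  have lim: "(\<lambda>n. ln (real (card {t \<in> Omega n. real (S (Suc r) t) > real n * dphi_iter r z}) / real (card (Omega n))) / real n)
      \<longlonglongrightarrow> (phi ^^ r) z - z * dphi_iter r z"
    by (rule gaertner_ellis_upper_tail[OF finite_Omega Omega_eventually_nonempty log_mgf_limit
          phi_iter_above_tangent[OF assms] isCont_phi_iter isCont_dphi_iter z(1)])
  have ev: "\<forall>\<^sub>F n in sequentially.
      ln (real (card {t \<in> Omega n. real (S (Suc r) t) > real n * dphi_iter r z}) / real (card (Omega n))) / real n =
      ln (Prob n (\<lambda>t. real (S (r + 1) t) / real n > y)) / real n"
    using eventually_gt_at_top[of 0]
    by eventually_elim (simp add: Prob_def z(2) pos_less_divide_eq mult.commute)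
  have val: "(phi ^^ r) z - z * dphi_iter r z = - rate r y"
    using rate_eq[OF assms, of z] z(2) by simp
  show "(\<lambda>n. ln (Prob n (\<lambda>t. real (S (r + 1) t) / real n > y)) / real n) \<longlonglongrightarrow> - rate r y"
    using Lim_transform_eventually[OF lim ev] unfolding val .
next
  fix y :: real assume y: "0 < y" "y < 1 / 4 ^ r"
  obtain z where z: "z \<le> 0" "dphi_iter r z = y" using dphi_iter_attains_lower[OF assms y] .
  \<comment> \<open>The lower tail is the upper tail of the negated count: its limiting function is
    reflected, and the tilt is \<open>- z \<ge> 0\<close>. The double negations keep the terms in
    the form obtained by instantiating \<open>F\<close> and \<open>F'\<close> at
    \<open>- z\<close>.\<close>
  have lim: "(\<lambda>n. ln (real (card {t \<in> Omega n. - real (S (Suc r) t) > real n * - dphi_iter r (- (- z))}) / real (card (Omega n))) / real n)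
      \<longlonglongrightarrow> (phi ^^ r) (- (- z)) - (- z) * - dphi_iter r (- (- z))"
  proof (rule gaertner_ellis_upper_tail[OF finite_Omega Omega_eventually_nonempty,
        where F = "\<lambda>x. (phi ^^ r) (- x)" and F' = "\<lambda>x. - dphi_iter r (- x)"])
    show "(\<lambda>n. ln ((\<Sum>t\<in>Omega n. exp (x * - real (S (Suc r) t))) / real (card (Omega n))) / real n)
        \<longlonglongrightarrow> (phi ^^ r) (- x)" for x
      using log_mgf_limit[where x = "- x"] by simp
    show "(phi ^^ r) (- u) + - dphi_iter r (- u) * (x - u) < (phi ^^ r) (- x)" if "x \<noteq> u" for x u
      using phi_iter_above_tangent[OF assms, of "- x" "- u"] that by (simp add: algebra_simps)
    show "isCont (\<lambda>x. (phi ^^ r) (- x)) (- z)"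
      by (rule isCont_o2[OF _ isCont_phi_iter]) simp
    show "isCont (\<lambda>x. - dphi_iter r (- x)) (- z)"
      by (intro continuous_minus isCont_o2[OF _ isCont_dphi_iter]) simp
  qed (use z in simp)
  have ev: "\<forall>\<^sub>F n in sequentially.
      ln (real (card {t \<in> Omega n. - real (S (Suc r) t) > real n * - dphi_iter r (- (- z))}) / real (card (Omega n))) / real n =
      ln (Prob n (\<lambda>t. real (S (r + 1) t) / real n < y)) / real n"
    using eventually_gt_at_top[of 0]
    by eventually_elim (simp add: Prob_def z(2) pos_divide_less_eq mult.commute)
  have val: "(phi ^^ r) (- (- z)) - (- z) * - dphi_iter r (- (- z)) = - rate r y"
    using rate_eq[OF assms, of z] z(2) by simp
  show "(\<lambda>n. ln (Prob n (\<lambda>t. real (S (r + 1) t) / real n < y)) / real n) \<longlonglongrightarrow> - rate r y"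
    using Lim_transform_eventually[OF lim ev] unfolding val .
qed

end
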